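(* Let $[a,b]\subset\mathbb{R}$ with $b-a<4$. If $P_n(x)=a_nx^n+\ldots\in\mathbb{Z}_n^s([a,b])$ is any sequence of polynomials that are irreducible over $\mathbb{Q}$, with degrees $n\to\infty$, then $$\liminf_{n\to\infty}|a_n|^{1/n}\ge\frac{1}{t_{\mathbb{Z}}([a,b])}\ge\frac{2}{\sqrt{b-a}}.$$
   Context: Here $a<b$. For $E\subset\mathbb{C}$, $\mathbb{Z}_n^s(E)$ denotes the set of polynomials with integer coefficients, of exact degree $n$, all of whose zeros are simple and lie in $E$; $a_n\neq0$ is the leading coefficient of $P_n$. Let $\mathbb{Z}_n$ be the set of polynomials of degree at most $n$ with integer coefficients, and $\|f\|_{[a,b]}:=\sup_{x\in[a,b]}|f(x)|$. The integer Chebyshev constant of $[a,b]$ is $$t_{\mathbb{Z}}([a,b]):=\lim_{n\to\infty}\Big(\inf_{0\not\equiv Q\in\mathbb{Z}_n}\|Q\|_{[a,b]}\Big)^{1/n}$$ (the limit exists). The sequence $(P_n)$ is indexed by the degrees of its members, which run through an infinite set of positive integers. *)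

theory Defs
  imports "HOL-Analysis.Analysis" "HOL-Computational_Algebra.Computational_Algebra"
begin

definition int_polys_le :: "nat \<Rightarrow> int poly set" where
  "int_polys_le n = {Q. degree Q \<le> n}"

text \<open>All complex zeros are counted, so membership with \<open>E\<close> the image of a real interval
  includes real-rootedness.\<close>

definition int_polys_simple :: "nat \<Rightarrow> complex set \<Rightarrow> int poly set" where
  "int_polys_simple n E =
     {P. P \<noteq> 0 \<and> degree P = n \<and>
         (\<forall>z::complex. poly (map_poly of_int P) z = 0 \<longrightarrow>
              order z (map_poly of_int P) = 1 \<and> z \<in> E)}"

definition sup_norm_on :: "real \<Rightarrow> real \<Rightarrow> (real \<Rightarrow> real) \<Rightarrow> real" where
  "sup_norm_on a b f = (SUP x\<in>{a..b}. \<bar>f x\<bar>)"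

text \<open>For \<open>a \<le> b\<close> the infima are submultiplicative in \<open>n\<close>, so the limit exists and \<open>lim\<close> is
  its value. The index \<open>n = 0\<close>, where \<open>root\<close> is degenerate, has no effect on it.\<close>

definition int_chebyshev_const :: "real \<Rightarrow> real \<Rightarrow> real" where
  "int_chebyshev_const a b =
     lim (\<lambda>n. root n (INF Q\<in>int_polys_le n - {0}.
                          sup_norm_on a b (poly (map_poly real_of_int Q))))"

end

theory Submission
  imports Defs "HOL-Computational_Algebra.Field_as_Ring" "Jordan_Normal_Form.Char_Poly"
begin

text \<open>Write \<open>M m\<close> for the infimum of \<open>\<parallel>Q\<parallel>\<close> on \<open>[a, b]\<close> over the nonzero integer polynomials \<open>Q\<close> of
  degree at most \<open>m\<close>, so that the integer Chebyshev constant is \<open>t = lim (M m) ^ (1/m)\<close>.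

  The first inequality compares \<open>M m\<close>, for a fixed \<open>m\<close>, with the leading coefficient \<open>A\<close> of an
  irreducible \<open>P\<close> of degree \<open>n > m\<close> with zeros \<open>x\<^sub>1, \<dots>, x\<^sub>n\<close> in \<open>[a, b]\<close>. For every
  nonzero \<open>Q\<close> of degree at most \<open>m\<close> the number \<open>A ^ m * Q x\<^sub>1 * \<dots> * Q x\<^sub>n\<close> is, up to sign and a power
  of \<open>A\<close>, the resultant of \<open>P\<close> and \<open>Q\<close>, hence an integer (\<open>prod_values_at_roots_int\<close>). It is not
  zero, because \<open>P\<close> is irreducible and of larger degree than \<open>Q\<close>
  (\<open>irreducible_no_common_root\<close>). Therefore \<open>1 \<le> \<bar>A\<bar> ^ m * \<parallel>Q\<parallel> ^ n\<close>, and taking roots and the infimum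
  over \<open>Q\<close> gives \<open>\<bar>A\<bar> ^ (1/n) \<ge> (M m) ^ (-1/m)\<close>. Since the degrees tend to infinity, the lower limit
  of \<open>\<bar>A\<bar> ^ (1/n)\<close> is at least \<open>(M m) ^ (-1/m)\<close> for every \<open>m\<close>, and \<open>m\<close> can now tend to infinity.

  The second inequality amounts to \<open>0 < t \<le> sqrt (b - a) / 2\<close>. The upper bound is the theorem of
  Hilbert and Fekete. Expanded in the Chebyshev polynomials of \<open>[a, b]\<close>, an integer polynomial of
  degree at most \<open>n\<close> has coordinates that are triangular linear forms in its \<open>n + 1\<close> coefficients, with
  diagonal entries at most \<open>2 * ((b - a) / 4) ^ j\<close>. Minkowski's theorem for triangular forms
  (\<open>triangular_forms_small_value\<close>), which is a pigeonhole argument, provides a nonzero integer point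
  at which all forms are below any bound whose \<open>(n + 1)\<close>-st power exceeds the product of the
  diagonal entries, and this product is at most the \<open>(n + 1)\<close>-st power of
  \<open>2 * (sqrt (b - a) / 2) ^ n\<close>. The Chebyshev polynomials
  are bounded by 1, so the resulting \<open>Q\<close> is at most \<open>n + 1\<close> times as large as the bound on its
  coordinates (\<open>small_int_poly_on_interval\<close>).
  The lower bound on \<open>t\<close> holds because a polynomial whose leading coefficient is at least 1 in
  absolute value cannot be smaller on an interval than a fixed constant to the power of its degree;
  finite differences show this (\<open>sup_lower_bound_of_leading_coeff\<close>).
  Finally, the limit that defines \<open>t\<close> exists by Fekete's lemma, as \<open>M\<close> is submultiplicative.\<close>

unbundle no vec_syntax
hide_const (open) Module.smult

section \<open>Products of polynomial values over the zeros of an integer polynomial\<close>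

text \<open>A vector in the left kernel of the matrix is the coefficient vector of a polynomial of degree
  below \<open>n\<close> that vanishes at \<open>n\<close> distinct points.\<close>

lemma vandermonde_det_nonzero:
  fixes x :: "nat \<Rightarrow> 'a::field"
  assumes "inj_on x {..<n}"
  shows "det (mat n n (\<lambda>(k, j). x j ^ k)) \<noteq> 0"
proof
  let ?V = "mat n n (\<lambda>(k, j). x j ^ k)"
  assume "det ?V = 0"
  then have "det (transpose_mat ?V) = 0"
    by (subst det_transpose) auto
  then obtain v where v: "v \<in> carrier_vec n" "v \<noteq> 0\<^sub>v n" "transpose_mat ?V *\<^sub>v v = 0\<^sub>v n"
    by (subst (asm) det_0_iff_vec_prod_zero_field[of _ n]) auto
  define p where "p = (\<Sum>k<n. monom (v $ k) k)"
  have coeff_p: "coeff p k = (if k < n then v $ k else 0)" for k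
    by (simp add: p_def coeff_sum)
  have zero: "poly p (x j) = 0" if "j < n" for j
  proof -
    have "(transpose_mat ?V *\<^sub>v v) $ j = 0"
      using v that by simp
    then have "(\<Sum>k<n. x j ^ k * v $ k) = 0"
      using that carrier_vecD[OF v(1)] by (simp add: scalar_prod_def atLeast0LessThan)
    then show ?thesis
      by (simp add: p_def poly_sum poly_monom mult.commute)
  qed
  have "p \<noteq> 0"
  proof
    assume "p = 0"
    then have "v $ k = 0" if "k < n" for k
      using coeff_p[of k] that by simp
    with v show False
      by (metis carrier_vecD eq_vecI index_zero_vec(1) index_zero_vec(2))
  qed
  have "n = card (x ` {..<n})"
    using assms by (simp add: card_image)
  also have "\<dots> \<le> card {z. poly p z = 0}"
    using \<open>p \<noteq> 0\<close> zero by (intro card_mono poly_roots_finite) auto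
  also have "\<dots> \<le> degree p"
    using \<open>p \<noteq> 0\<close> by (rule card_poly_roots_bound)
  finally have "n \<le> degree p" .
  then have "coeff p (degree p) = 0"
    by (simp add: coeff_p)
  with \<open>p \<noteq> 0\<close> show False
    by simp
qed

text \<open>If \<open>d\<close> is the degree of \<open>Q\<close>, the number in question is up to sign the resultant of \<open>P\<close> and \<open>Q\<close>.
  The rows of the integer matrix \<open>S\<close>, a Sylvester matrix, are the polynomials \<open>x ^ i * Q\<close> for \<open>i < n\<close>
  and \<open>x ^ i * P\<close> for \<open>i < d\<close>. Multiplication by \<open>W\<close> replaces the \<open>n\<close> lowest coefficients of a
  polynomial by its values at the \<open>n\<close> zeros of \<open>P\<close>. The rows of the second kind then become zero in
  these columns, which leaves the block triangular determinant
  \<open>det S * det V = (det V * (\<Prod>i<n. Q (x i))) * lead_coeff P ^ d\<close> with the Vandermonde matrix \<open>V\<close> of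
  the zeros.\<close>

lemma prod_values_at_roots_int:
  fixes P Q :: "int poly" and x :: "nat \<Rightarrow> 'a::field_char_0"
  assumes inj: "inj_on x {..<n}"
    and roots: "\<And>i. i < n \<Longrightarrow> poly (map_poly of_int P) (x i) = 0"
    and degP: "degree P = n" and degQ: "degree Q \<le> d"
  shows "(\<Prod>i<n. poly (map_poly of_int Q) (x i)) * of_int (lead_coeff P) ^ d \<in> \<int>"
proof -
  let ?h = "map_poly (of_int :: int \<Rightarrow> 'a)"
  define r where "r i = (if i < n then monom 1 i * Q else monom 1 (i - n) * P)" for i
  define S where "S = mat (n + d) (n + d) (\<lambda>(i, k). coeff (r i) k)"
  define V where "V = mat n n (\<lambda>(k, j). x j ^ k)"
  define X where "X = mat d n (\<lambda>(k, j). x j ^ (n + k))"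
  define W where "W = four_block_mat V (0\<^sub>m n d) X (1\<^sub>m d)"
  define B where "B = mat n n (\<lambda>(i, j). x j ^ i * poly (?h Q) (x j))"
  define C where "C = mat n d (\<lambda>(i, j). of_int (coeff (r i) (n + j)) :: 'a)"
  define A where "A = mat d d (\<lambda>(i, j). of_int (coeff (r (n + i)) (n + j)) :: 'a)"
  have carrier: "S \<in> carrier_mat (n + d) (n + d)" "V \<in> carrier_mat n n" "X \<in> carrier_mat d n"
    "B \<in> carrier_mat n n" "C \<in> carrier_mat n d" "A \<in> carrier_mat d d"
    by (auto simp: S_def V_def X_def B_def C_def A_def)
  have W: "W = mat (n + d) (n + d) (\<lambda>(k, j). if j < n then x j ^ k else if k = j then 1 else 0)"
    by (rule eq_matI) (auto simp: W_def V_def X_def)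
  have deg_r: "degree (r i) < n + d" if "i < n + d" for i
  proof (cases "i < n")
    case True
    have "degree (r i) \<le> i + degree Q"
      using True degree_mult_le[of "monom 1 i" Q] by (simp add: r_def degree_monom_eq)
    then show ?thesis using True degQ by simp
  next
    case False
    have "degree (r i) \<le> (i - n) + n"
      using False degree_mult_le[of "monom 1 (i - n)" P] by (simp add: r_def degree_monom_eq degP)
    then show ?thesis using False that by simp
  qed
  have eval: "(\<Sum>k<n + d. of_int (coeff (r i) k) * y ^ k) = poly (?h (r i)) y"
    if "i < n + d" for i and y :: 'a
  proof -
    have "poly (?h (r i)) y = (\<Sum>k\<le>degree (r i). of_int (coeff (r i) k) * y ^ k)"
      by (simp add: poly_altdef degree_map_poly coeff_map_poly)
    also have "\<dots> = (\<Sum>k<n + d. of_int (coeff (r i) k) * y ^ k)"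
      using deg_r[OF that] by (intro sum.mono_neutral_left) (auto simp: coeff_eq_0)
    finally show ?thesis by simp
  qed
  have poly_r: "poly (?h (r i)) (x j) = (if i < n then x j ^ i * poly (?h Q) (x j) else 0)"
    if "j < n" for i j
    using roots[OF that] by (simp add: r_def of_int_poly_hom.hom_mult poly_monom)
  have SW: "map_mat of_int S * W = four_block_mat B C (0\<^sub>m d n) A"
  proof (rule eq_matI)
    fix i j
    assume "i < dim_row (four_block_mat B C (0\<^sub>m d n) A)" "j < dim_col (four_block_mat B C (0\<^sub>m d n) A)"
    then have ij: "i < n + d" "j < n + d"
      using carrier by auto
    have "(map_mat of_int S * W) $$ (i, j) =
        (\<Sum>k<n + d. of_int (coeff (r i) k) * (if j < n then x j ^ k else if k = j then 1 else 0))"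
      using ij by (simp add: W S_def scalar_prod_def atLeast0LessThan)
    also have "\<dots> = (if j < n then poly (?h (r i)) (x j) else of_int (coeff (r i) j))"
      using ij eval by (simp add: if_distrib[of "(*) _"] cong: if_cong)
    also have "\<dots> = four_block_mat B C (0\<^sub>m d n) A $$ (i, j)"
      using ij carrier by (auto simp: B_def C_def A_def poly_r)
    finally show "(map_mat of_int S * W) $$ (i, j) = four_block_mat B C (0\<^sub>m d n) A $$ (i, j)" .
  qed (use carrier in \<open>auto simp: W_def\<close>)
  have "det W = det V"
    unfolding W_def using carrier by (subst det_four_block_mat_upper_right_zero[of _ n _ d]) auto
  moreover have "det (map_mat of_int S * W) = det (map_mat (of_int :: int \<Rightarrow> 'a) S) * det W"
    using carrier by (intro det_mult[of _ "n + d"]) (auto simp: W)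
  moreover have "det (map_mat of_int S * W) = det B * det A"
    unfolding SW using carrier by (subst det_four_block_mat_lower_left_zero[of _ n _ d]) auto
  moreover have "det B = det V * (\<Prod>i<n. poly (?h Q) (x i))"
  proof -
    let ?D = "mat n n (\<lambda>(i, j). if i = j then poly (?h Q) (x j) else 0)"
    have "B = V * ?D"
      by (rule eq_matI)
        (auto simp: B_def V_def scalar_prod_def if_distrib[of "(*) _"] cong: if_cong)
    moreover have "det ?D = (\<Prod>i<n. poly (?h Q) (x i))"
      by (subst det_lower_triangular[of n])
        (auto simp: diag_mat_def prod.list_conv_set_nth atLeast0LessThan)
    moreover have "det (V * ?D) = det V * det ?D"
      using carrier by (intro det_mult[of _ n]) auto
    ultimately show ?thesis by simp
  qed
  moreover have "det A = of_int (lead_coeff P) ^ d"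
  proof -
    have coeff_A: "A $$ (i, j) = of_int (if i \<le> n + j then coeff P (n + j - i) else 0)"
      if "i < d" "j < d" for i j
      using that by (simp add: A_def r_def coeff_monom_mult)
    have "det A = prod_list (diag_mat A)"
      by (rule det_lower_triangular[OF _ carrier(6)]) (auto simp: coeff_A degP coeff_eq_0)
    also have "diag_mat A = replicate d (of_int (lead_coeff P))"
      using carrier by (intro nth_equalityI) (auto simp: diag_mat_def coeff_A degP)
    finally show ?thesis by simp
  qed
  moreover have "det V \<noteq> 0"
    unfolding V_def using inj by (rule vandermonde_det_nonzero)
  ultimately have "(\<Prod>i<n. poly (?h Q) (x i)) * of_int (lead_coeff P) ^ d
      = det (map_mat (of_int :: int \<Rightarrow> 'a) S)"
    by simp
  also have "\<dots> = of_int (det S)"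
    by (rule of_int_hom.hom_det)
  finally show ?thesis by simp
qed

text \<open>An irreducible polynomial that does not divide \<open>Q\<close> over the rationals is coprime to it, and a common
  zero would contradict the Bezout identity.\<close>

lemma irreducible_no_common_root:
  fixes P Q :: "int poly" and z :: "'a::field_char_0"
  assumes irr: "irreducible (map_poly rat_of_int P)"
    and deg: "degree Q < degree P" and "Q \<noteq> 0"
    and root: "poly (map_poly of_int P) z = 0"
  shows "poly (map_poly of_int Q) z \<noteq> 0"
proof
  assume rootQ: "poly (map_poly of_int Q) z = 0"
  let ?r = "map_poly rat_of_int" and ?h = "map_poly (of_rat :: rat \<Rightarrow> 'a)"
  interpret of_rat: field_hom "of_rat :: rat \<Rightarrow> 'a"
    by unfold_locales (auto simp: of_rat_add of_rat_mult)
  interpret h: map_poly_comm_ring_hom "of_rat :: rat \<Rightarrow> 'a" ..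
  have hr: "?h (?r R) = map_poly of_int R" for R
    by (rule poly_eqI) (simp add: coeff_map_poly)
  have "\<not> ?r P dvd ?r Q"
  proof
    assume "?r P dvd ?r Q"
    moreover have "?r Q \<noteq> 0" using \<open>Q \<noteq> 0\<close> by simp
    ultimately have "degree (?r P) \<le> degree (?r Q)" by (rule dvd_imp_degree_le)
    with deg show False by simp
  qed
  with irreducible_imp_prime_elem_gcd[OF irr] have "coprime (?r P) (?r Q)"
    by (rule prime_elem_imp_coprime)
  obtain u v where "bezout_coefficients (?r P) (?r Q) = (u, v)"
    by (rule prod.exhaust)
  then have "u * ?r P + v * ?r Q = 1"
    using bezout_coefficients[of "?r P" "?r Q" u v] \<open>coprime (?r P) (?r Q)\<close>
    by (simp only: coprime_iff_gcd_eq_1)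
  then have "?h (u * ?r P + v * ?r Q) = 1" by simp
  then have "?h u * map_poly of_int P + ?h v * map_poly of_int Q = 1"
    by (simp only: h.hom_add h.hom_mult hr)
  then have "poly (?h u * map_poly of_int P + ?h v * map_poly of_int Q) z = 1" by simp
  with root rootQ show False by simp
qed

section \<open>Minkowski's theorem for triangular linear forms\<close>

text \<open>The counting half of the pigeonhole argument. The coefficient \<open>c n\<close> is chosen first: the last form
  depends on it alone, in steps of length \<open>m n n\<close>, so exactly \<open>N\<close> values of \<open>c n\<close> bring that form into
  an interval of length \<open>N * m n n\<close>. Every choice shifts the other forms by a constant, which is
  why the offset \<open>r\<close> is needed for the induction.\<close>

lemma many_values_in_box:
  fixes m :: "nat \<Rightarrow> nat \<Rightarrow> real" and r :: "nat \<Rightarrow> real"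
  assumes "\<And>j. j < n \<Longrightarrow> m j j > 0" and "\<And>k j. k < j \<Longrightarrow> m k j = 0"
  shows "\<exists>S :: (nat \<Rightarrow> int) set. finite S \<and> card S = N ^ n \<and>
    (\<forall>c\<in>S. (\<forall>k\<ge>n. c k = 0) \<and>
      (\<forall>j<n. r j + (\<Sum>k<n. of_int (c k) * m k j) \<in> {0..<m j j * real N}))"
  using assms
proof (induction n arbitrary: r)
  case 0
  show ?case by (rule exI[of _ "{\<lambda>_. 0}"]) auto
next
  case (Suc n)
  \<comment> \<open>the \<open>N\<close> admissible values of the coefficient \<open>c n\<close>\<close>
  define s where "s i = int i + \<lceil>- r n / m n n\<rceil>" for i :: nat
  have pos: "m n n > 0" using Suc.prems by simp
  have s_box: "r n + of_int (s i) * m n n \<in> {0..<m n n * real N}" if "i < N" for i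
  proof -
    define t where "t = r n / m n n"
    have r: "r n = t * m n n" using pos by (simp add: t_def)
    have "t + of_int (s i) \<ge> 0" "t + of_int (s i) < real i + 1"
      unfolding s_def t_def by (simp_all, linarith+)
    moreover have "real i + 1 \<le> real N" using that by linarith
    ultimately have "t + of_int (s i) \<ge> 0" "t + of_int (s i) < real N" by linarith+
    then have "(t + of_int (s i)) * m n n \<in> {0..<real N * m n n}"
      using pos by simp
    then show ?thesis unfolding r by (simp add: algebra_simps)
  qed
  have "\<forall>i. \<exists>S :: (nat \<Rightarrow> int) set. finite S \<and> card S = N ^ n \<and>
      (\<forall>c\<in>S. (\<forall>k\<ge>n. c k = 0) \<and>
        (\<forall>j<n. r j + of_int (s i) * m n j + (\<Sum>k<n. of_int (c k) * m k j) \<in> {0..<m j j * real N}))"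
  proof
    fix i
    have "\<And>j. j < n \<Longrightarrow> m j j > 0" using Suc.prems(1) by simp
    from Suc.IH[OF this Suc.prems(2), of "\<lambda>j. r j + of_int (s i) * m n j"]
    show "\<exists>S :: (nat \<Rightarrow> int) set. finite S \<and> card S = N ^ n \<and>
      (\<forall>c\<in>S. (\<forall>k\<ge>n. c k = 0) \<and>
        (\<forall>j<n. r j + of_int (s i) * m n j + (\<Sum>k<n. of_int (c k) * m k j) \<in> {0..<m j j * real N}))"
      by blast
  qed
  from choice[OF this] obtain S :: "nat \<Rightarrow> (nat \<Rightarrow> int) set" where
    S_all: "\<forall>i. finite (S i) \<and> card (S i) = N ^ n \<and> (\<forall>c\<in>S i. (\<forall>k\<ge>n. c k = 0) \<and>
      (\<forall>j<n. r j + of_int (s i) * m n j + (\<Sum>k<n. of_int (c k) * m k j) \<in> {0..<m j j * real N}))"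
    by (rule exE)
  have S: "\<And>i. finite (S i)" "\<And>i. card (S i) = N ^ n"
      "\<And>i c k. c \<in> S i \<Longrightarrow> k \<ge> n \<Longrightarrow> c k = 0"
      "\<And>i c j. c \<in> S i \<Longrightarrow> j < n \<Longrightarrow>
        r j + of_int (s i) * m n j + (\<Sum>k<n. of_int (c k) * m k j) \<in> {0..<m j j * real N}"
    using S_all by blast+
  define T where "T = (\<lambda>(i, c). c(n := s i)) ` (SIGMA i:{..<N}. S i)"
  have "inj_on (\<lambda>(i, c). c(n := s i)) (SIGMA i:{..<N}. S i)"
  proof (rule inj_onI, clarsimp)
    fix i c i' c' assume *: "c \<in> S i" "c' \<in> S i'" "c(n := s i) = c'(n := s i')"
    have "s i = s i'" using *(3) by (metis fun_upd_same)
    then have "i = i'" by (simp add: s_def)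
    moreover have "c k = c' k" for k
      using *(3) S(3)[OF *(1), of n] S(3)[OF *(2), of n] by (metis fun_upd_other le_refl)
    ultimately show "i = i' \<and> c = c'" by auto
  qed
  then have "card T = N ^ Suc n"
    unfolding T_def by (simp add: card_image S)
  moreover have "finite T"
    unfolding T_def using S(1) by auto
  moreover have "(\<forall>k\<ge>Suc n. c k = 0) \<and>
      (\<forall>j<Suc n. r j + (\<Sum>k<Suc n. of_int (c k) * m k j) \<in> {0..<m j j * real N})"
    if "c \<in> T" for c
  proof -
    from that obtain i c' where i: "i < N" "c' \<in> S i" and c: "c = c'(n := s i)"
      by (auto simp: T_def)
    have sum: "(\<Sum>k<Suc n. of_int (c k) * m k j) = of_int (s i) * m n j + (\<Sum>k<n. of_int (c' k) * m k j)" for j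
      by (simp add: c)
    have "r j + (\<Sum>k<Suc n. of_int (c k) * m k j) \<in> {0..<m j j * real N}" if "j < Suc n" for j
    proof (cases "j = n")
      case True
      have "(\<Sum>k<n. of_int (c' k) * m k n) = 0"
        using Suc.prems(2) by (intro sum.neutral) auto
      then show ?thesis
        using s_box[OF i(1)] unfolding sum True by simp
    next
      case False
      then show ?thesis
        using S(4)[OF i(2), of j] that unfolding sum by (simp add: add.assoc)
    qed
    moreover have "\<forall>k\<ge>Suc n. c k = 0"
      using S(3)[OF i(2)] by (simp add: c)
    ultimately show ?thesis by blast
  qed
  ultimately show ?case by blast
qed

text \<open>There are \<open>N ^ n\<close> integer points in the box with sides \<open>m j j * N\<close>, and the box is covered by
  \<open>\<Prod>j<n. \<lceil>m j j * N / \<epsilon>\<rceil>\<close> cubes with side \<open>\<epsilon>\<close>. The quotient of the second number by the first is at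
  most \<open>\<Prod>j<n. m j j / \<epsilon> + 1 / N\<close>, which is below 1 for large \<open>N\<close> because of the bound on
  \<open>\<Prod>j<n. m j j\<close>. Hence two points lie in the same cube, and their difference is the required point.\<close>

lemma triangular_forms_small_value:
  fixes m :: "nat \<Rightarrow> nat \<Rightarrow> real"
  assumes pos: "\<And>j. j < n \<Longrightarrow> m j j > 0" and tri: "\<And>k j. k < j \<Longrightarrow> m k j = 0"
    and "\<epsilon> > 0" and det: "(\<Prod>j<n. m j j) < \<epsilon> ^ n"
  shows "\<exists>c :: nat \<Rightarrow> int. (\<exists>k<n. c k \<noteq> 0) \<and> (\<forall>j<n. \<bar>\<Sum>k<n. of_int (c k) * m k j\<bar> < \<epsilon>)"
proof -
  have "((\<lambda>N. \<Prod>j<n. m j j / \<epsilon> + 1 / real N) \<longlongrightarrow> (\<Prod>j<n. m j j / \<epsilon> + 0)) sequentially"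
    by (intro tendsto_intros lim_1_over_n)
  moreover have "(\<Prod>j<n. m j j / \<epsilon> + 0) < 1"
    using det \<open>\<epsilon> > 0\<close> by (simp add: prod_dividef)
  ultimately have "\<forall>\<^sub>F N in sequentially. (\<Prod>j<n. m j j / \<epsilon> + 1 / real N) < 1"
    by (rule order_tendstoD)
  then have "\<forall>\<^sub>F N in sequentially. (\<Prod>j<n. m j j / \<epsilon> + 1 / real N) < 1 \<and> N > 0"
    using eventually_gt_at_top[of 0] by eventually_elim simp
  then obtain N where N: "(\<Prod>j<n. m j j / \<epsilon> + 1 / real N) < 1" "N > 0"
    by (auto simp: eventually_sequentially)
  obtain S :: "(nat \<Rightarrow> int) set" where S: "finite S" "card S = N ^ n"
    "\<And>c k. c \<in> S \<Longrightarrow> k \<ge> n \<Longrightarrow> c k = 0"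
    "\<And>c j. c \<in> S \<Longrightarrow> j < n \<Longrightarrow> (\<Sum>k<n. of_int (c k) * m k j) \<in> {0..<m j j * real N}"
    using many_values_in_box[of n m N "\<lambda>_. 0", OF pos tri] by auto
  define L where "L c j = (\<Sum>k<n. of_int (c k) * m k j)" for c :: "nat \<Rightarrow> int" and j
  define b where "b j = nat \<lceil>m j j * real N / \<epsilon>\<rceil>" for j
  define cell where "cell c = restrict (\<lambda>j. nat \<lfloor>L c j / \<epsilon>\<rfloor>) {..<n}" for c
  have "cell ` S \<subseteq> PiE {..<n} (\<lambda>j. {..<b j})"
  proof (rule image_subsetI)
    fix c assume c: "c \<in> S"
    have "nat \<lfloor>L c j / \<epsilon>\<rfloor> < b j" if "j < n" for j
    proof -
      have L: "0 \<le> L c j" "L c j < m j j * real N"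
        using S(4)[OF c that] by (auto simp: L_def)
      have "L c j / \<epsilon> < m j j * real N / \<epsilon>"
        using L(2) \<open>\<epsilon> > 0\<close> by (rule divide_strict_right_mono)
      then have "\<lfloor>L c j / \<epsilon>\<rfloor> < \<lceil>m j j * real N / \<epsilon>\<rceil>" by linarith
      moreover have "0 \<le> \<lfloor>L c j / \<epsilon>\<rfloor>" using L(1) \<open>\<epsilon> > 0\<close> by simp
      ultimately show ?thesis unfolding b_def by linarith
    qed
    then show "cell c \<in> PiE {..<n} (\<lambda>j. {..<b j})" by (auto simp: cell_def)
  qed
  then have "card (cell ` S) \<le> card (PiE {..<n} (\<lambda>j. {..<b j}))"
    by (intro card_mono finite_PiE) auto
  also have "\<dots> = (\<Prod>j<n. b j)" by (simp add: card_PiE)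
  also have "\<dots> < N ^ n"
  proof -
    have "real (\<Prod>j<n. b j) = (\<Prod>j<n. real (b j))" by simp
    also have "\<dots> \<le> (\<Prod>j<n. real N * (m j j / \<epsilon> + 1 / real N))"
    proof (rule prod_mono)
      fix j assume "j \<in> {..<n}"
      then have "0 < m j j * real N / \<epsilon>" using pos N(2) \<open>\<epsilon> > 0\<close> by simp
      then have "real (b j) \<le> m j j * real N / \<epsilon> + 1" unfolding b_def by linarith
      also have "m j j * real N / \<epsilon> + 1 = real N * (m j j / \<epsilon> + 1 / real N)"
        using N(2) by (simp add: distrib_left)
      finally show "0 \<le> real (b j) \<and> real (b j) \<le> real N * (m j j / \<epsilon> + 1 / real N)"
        by simp
    qed
    also have "\<dots> = real N ^ n * (\<Prod>j<n. m j j / \<epsilon> + 1 / real N)"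
      by (simp add: prod.distrib)
    also have "\<dots> < real N ^ n * 1"
      using N by (intro mult_strict_left_mono) auto
    finally have "real (\<Prod>j<n. b j) < real (N ^ n)" by simp
    then show ?thesis by (simp only: of_nat_less_iff)
  qed
  finally have "card (cell ` S) < card S" using S(2) by simp
  then have "\<not> inj_on cell S" by (rule pigeonhole)
  then obtain c c' where c: "c \<in> S" "c' \<in> S" "cell c = cell c'" "c \<noteq> c'"
    by (auto simp: inj_on_def)
  define e where "e k = c k - c' k" for k
  have "\<exists>k<n. e k \<noteq> 0"
  proof (rule ccontr)
    assume "\<not> (\<exists>k<n. e k \<noteq> 0)"
    then have "c k = c' k" for k
      using S(3)[OF c(1)] S(3)[OF c(2)] by (cases "k < n") (auto simp: e_def)
    with c(4) show False by auto
  qed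
  moreover have "\<bar>\<Sum>k<n. of_int (e k) * m k j\<bar> < \<epsilon>" if j: "j < n" for j
  proof -
    have "nat \<lfloor>L c j / \<epsilon>\<rfloor> = nat \<lfloor>L c' j / \<epsilon>\<rfloor>"
      using fun_cong[OF c(3), of j] j by (simp add: cell_def)
    moreover have "0 \<le> L c j / \<epsilon>" "0 \<le> L c' j / \<epsilon>"
      using S(4)[OF c(1) j] S(4)[OF c(2) j] \<open>\<epsilon> > 0\<close> by (auto simp: L_def)
    ultimately have "\<bar>L c j / \<epsilon> - L c' j / \<epsilon>\<bar> < 1" by linarith
    then have "\<bar>L c j - L c' j\<bar> < \<epsilon>"
      using \<open>\<epsilon> > 0\<close> by (simp add: diff_divide_distrib[symmetric])
    moreover have "(\<Sum>k<n. of_int (e k) * m k j) = L c j - L c' j"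
      by (simp add: L_def e_def left_diff_distrib sum_subtractf)
    ultimately show ?thesis by simp
  qed
  ultimately show ?thesis by blast
qed

section \<open>Integer polynomials of small norm on an interval\<close>

text \<open>The composition of the \<open>n\<close>-th Chebyshev polynomial of the first kind with \<open>l\<close>. For the affine \<open>l\<close>
  that maps \<open>[a, b]\<close> onto \<open>[-1, 1]\<close> these are the Chebyshev polynomials of \<open>[a, b]\<close>.\<close>

fun chebyshev_comp :: "real poly \<Rightarrow> nat \<Rightarrow> real poly" where
  "chebyshev_comp l 0 = 1"
| "chebyshev_comp l (Suc 0) = l"
| "chebyshev_comp l (Suc (Suc n)) = smult 2 (l * chebyshev_comp l (Suc n)) - chebyshev_comp l n"

lemma poly_chebyshev_comp:
  "poly l x = cos \<theta> \<Longrightarrow> poly (chebyshev_comp l n) x = cos (real n * \<theta>)"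
proof (induction l n rule: chebyshev_comp.induct)
  case (3 l n)
  have "cos (real (Suc (Suc n)) * \<theta>) + cos (real n * \<theta>) = 2 * cos \<theta> * cos (real (Suc n) * \<theta>)"
    using cos_add[of "real (Suc n) * \<theta>" \<theta>] cos_diff[of "real (Suc n) * \<theta>" \<theta>]
    by (simp add: algebra_simps)
  with 3 show ?case by simp
qed auto

lemma abs_poly_chebyshev_comp_le_1:
  assumes "\<bar>poly l x\<bar> \<le> 1"
  shows "\<bar>poly (chebyshev_comp l n) x\<bar> \<le> 1"
proof -
  have "poly l x = cos (arccos (poly l x))"
    using assms by (simp add: cos_arccos_abs)
  then show ?thesis
    by (simp add: poly_chebyshev_comp[of l x "arccos (poly l x)"])
qed

lemma chebyshev_comp_linear:
  "degree (chebyshev_comp [:p, q:] n) \<le> n"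
  "coeff (chebyshev_comp [:p, q:] n) n = (if n = 0 then 1 else 2 ^ (n - 1) * q ^ n)"
proof (induction "[:p, q:]" n rule: chebyshev_comp.induct)
  case (3 n)
  {
    case 1
    have "degree ([:p, q:] * chebyshev_comp [:p, q:] (Suc n)) \<le> Suc (Suc n)"
      using degree_mult_le[of "[:p, q:]" "chebyshev_comp [:p, q:] (Suc n)"] 3(1)
        degree_pCons_le[of p "[:q:]"] by (simp del: mult_pCons_left)
    then show ?case
      using 3(3) by (auto simp del: mult_pCons_left intro!: degree_diff_le order.trans[OF degree_smult_le])
  next
    case 2
    have "coeff (chebyshev_comp [:p, q:] (Suc n)) (Suc (Suc n)) = 0"
      "coeff (chebyshev_comp [:p, q:] n) (Suc (Suc n)) = 0"
      using 3(1,3) by (auto intro!: coeff_eq_0)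
    then show ?case using 3(2) by (simp add: coeff_pCons)
  }
qed (auto simp: degree_pCons_le)

text \<open>The last two conjuncts record that the transition matrix from such a basis to the monomials is
  triangular, with the inverses of the leading coefficients on its diagonal.\<close>

lemma graded_basis_expansion:
  fixes B :: "nat \<Rightarrow> 'a::field poly"
  assumes "\<And>j. degree (B j) \<le> j" and "\<And>j. coeff (B j) j \<noteq> 0" and "degree p \<le> n"
  shows "\<exists>y. p = (\<Sum>j\<le>n. smult (y j) (B j)) \<and> y n = coeff p n / coeff (B n) n \<and> (\<forall>j>n. y j = 0)"
  using assms(3)
proof (induction n arbitrary: p)
  case 0
  have "p = smult (coeff p 0 / coeff (B 0) 0) (B 0)"
  proof (rule poly_eqI)
    fix k show "coeff p k = coeff (smult (coeff p 0 / coeff (B 0) 0) (B 0)) k"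
      using assms(1)[of 0] assms(2)[of 0] 0 by (cases k) (auto simp: coeff_eq_0)
  qed
  then show ?case
    by (intro exI[of _ "\<lambda>j. if j = 0 then coeff p 0 / coeff (B 0) 0 else 0"]) auto
next
  case (Suc n)
  \<comment> \<open>subtracting this multiple of the top basis element lowers the degree\<close>
  define t where "t = coeff p (Suc n) / coeff (B (Suc n)) (Suc n)"
  have "degree (p - smult t (B (Suc n))) \<le> n"
  proof (rule degree_le, safe)
    fix i assume "n < i"
    then consider "i = Suc n" | "Suc n < i" by linarith
    then show "coeff (p - smult t (B (Suc n))) i = 0"
      using Suc.prems assms(1)[of "Suc n"] assms(2)[of "Suc n"]
      by cases (auto simp: t_def coeff_eq_0)
  qed
  from Suc.IH[OF this] obtain y where y:
    "p - smult t (B (Suc n)) = (\<Sum>j\<le>n. smult (y j) (B j))" "\<forall>j>n. y j = 0" by blast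
  have "p = (\<Sum>j\<le>n. smult (y j) (B j)) + smult t (B (Suc n))"
    using y(1) by (simp add: algebra_simps)
  also have "(\<Sum>j\<le>n. smult (y j) (B j)) = (\<Sum>j\<le>n. smult ((y(Suc n := t)) j) (B j))"
    by (intro sum.cong) auto
  finally show ?case
    using y(2) by (intro exI[of _ "y(Suc n := t)"]) (auto simp: t_def)
qed

text \<open>The coordinates of \<open>\<Sum>k\<le>n. c k * x ^ k\<close> in the basis \<open>B\<close> are triangular linear forms in \<open>c\<close>, and an
  integer point where they are all below \<open>\<epsilon>\<close> gives a polynomial that is bounded on \<open>I\<close> by
  \<open>n + 1\<close> times \<open>\<epsilon>\<close>.\<close>

lemma small_int_poly_exists:
  fixes B :: "nat \<Rightarrow> real poly"
  assumes deg: "\<And>j. degree (B j) \<le> j" and lc: "\<And>j. coeff (B j) j > 0"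
    and le1: "\<And>j x. x \<in> I \<Longrightarrow> \<bar>poly (B j) x\<bar> \<le> 1"
    and "\<epsilon> > 0" and less: "(\<Prod>j\<le>n. 1 / coeff (B j) j) < \<epsilon> ^ Suc n"
  shows "\<exists>Q :: int poly. Q \<noteq> 0 \<and> degree Q \<le> n \<and>
    (\<forall>x\<in>I. \<bar>poly (map_poly real_of_int Q) x\<bar> \<le> real (Suc n) * \<epsilon>)"
proof -
  have "\<exists>y. monom 1 k = (\<Sum>j\<le>k. smult (y j) (B j)) \<and> y k = 1 / coeff (B k) k \<and> (\<forall>j>k. y j = 0)" for k
  proof -
    have "coeff (B j) j \<noteq> 0" for j using lc[of j] by simp
    from graded_basis_expansion[OF deg this, of "monom 1 k" k] show ?thesis
      by (simp add: degree_monom_le)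
  qed
  then obtain m where m: "\<And>k. monom 1 k = (\<Sum>j\<le>k. smult (m k j) (B j))"
    "\<And>k. m k k = 1 / coeff (B k) k" "\<And>k j. k < j \<Longrightarrow> m k j = 0"
    by metis
  obtain c :: "nat \<Rightarrow> int" where c: "\<exists>k<Suc n. c k \<noteq> 0"
    "\<And>j. j < Suc n \<Longrightarrow> \<bar>\<Sum>k<Suc n. of_int (c k) * m k j\<bar> < \<epsilon>"
    using triangular_forms_small_value[of "Suc n" m \<epsilon>] m(2,3) lc less \<open>\<epsilon> > 0\<close>
    by (auto simp: lessThan_Suc_atMost)
  define Q where "Q = (\<Sum>k<Suc n. monom (c k) k)"
  have coeff_Q: "coeff Q k = (if k < Suc n then c k else 0)" for k
    by (simp add: Q_def coeff_sum del: sum.lessThan_Suc)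
  have "Q \<noteq> 0"
    using c(1) coeff_Q by (metis coeff_0)
  moreover have "degree Q \<le> n"
    by (rule degree_le) (simp add: coeff_Q)
  moreover have "\<bar>poly (map_poly real_of_int Q) x\<bar> \<le> real (Suc n) * \<epsilon>" if x: "x \<in> I" for x
  proof -
    have pow: "x ^ k = (\<Sum>j<Suc n. m k j * poly (B j) x)" if "k < Suc n" for k
    proof -
      have "x ^ k = poly (monom 1 k) x" by (simp add: poly_monom)
      also have "\<dots> = (\<Sum>j\<le>k. m k j * poly (B j) x)"
        by (subst m(1)) (simp add: poly_sum)
      also have "\<dots> = (\<Sum>j<Suc n. m k j * poly (B j) x)"
        using that by (intro sum.mono_neutral_left) (auto simp: m(3))
      finally show ?thesis .
    qed
    have "map_poly real_of_int Q = (\<Sum>k<Suc n. monom (of_int (c k)) k)"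
      by (rule poly_eqI) (simp add: coeff_map_poly coeff_Q coeff_sum del: sum.lessThan_Suc)
    then have "poly (map_poly real_of_int Q) x = (\<Sum>k<Suc n. of_int (c k) * x ^ k)"
      by (simp add: poly_sum poly_monom del: sum.lessThan_Suc)
    also have "\<dots> = (\<Sum>k<Suc n. \<Sum>j<Suc n. of_int (c k) * m k j * poly (B j) x)"
      by (intro sum.cong refl) (simp add: pow sum_distrib_left mult.assoc del: sum.lessThan_Suc)
    also have "\<dots> = (\<Sum>j<Suc n. (\<Sum>k<Suc n. of_int (c k) * m k j) * poly (B j) x)"
      by (subst sum.swap) (simp add: sum_distrib_right del: sum.lessThan_Suc)
    also have "\<bar>\<dots>\<bar> \<le> (\<Sum>j<Suc n. \<epsilon> * 1)"
    proof (rule order.trans[OF sum_abs sum_mono])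
      fix j assume "j \<in> {..<Suc n}"
      then show "\<bar>(\<Sum>k<Suc n. of_int (c k) * m k j) * poly (B j) x\<bar> \<le> \<epsilon> * 1"
        unfolding abs_mult using c(2)[of j] le1[OF x, of j] \<open>\<epsilon> > 0\<close>
        by (intro mult_mono) auto
    qed
    finally show ?thesis by simp
  qed
  ultimately show ?thesis by blast
qed

text \<open>With \<open>s = sqrt (b - a) / 2\<close>, the inverse leading coefficients of the Chebyshev polynomials of
  \<open>[a, b]\<close> are at most \<open>2 * s ^ (2 * j)\<close>. Their product for \<open>j \<le> n\<close> is at most
  \<open>(2 * s ^ n) ^ (n + 1)\<close>; the factor 3 in place of 2 makes the inequality strict.\<close>

lemma small_int_poly_on_interval:
  fixes a b :: real
  assumes "a < b"
  shows "\<exists>Q :: int poly. Q \<noteq> 0 \<and> degree Q \<le> n \<and>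
    (\<forall>x\<in>{a..b}. \<bar>poly (map_poly real_of_int Q) x\<bar> \<le> real (Suc n) * (3 * (sqrt (b - a) / 2) ^ n))"
proof (rule small_int_poly_exists)
  define s where "s = sqrt (b - a) / 2"
  have s: "s > 0" "s\<^sup>2 = (b - a) / 4"
    using assms by (auto simp: s_def power_divide)
  define l where "l = [:- (a + b) / (b - a), 2 / (b - a):]"
  show "degree (chebyshev_comp l j) \<le> j" for j
    unfolding l_def by (rule chebyshev_comp_linear)
  have lc: "coeff (chebyshev_comp l j) j = (if j = 0 then 1 else 2 ^ (j - 1) * (2 / (b - a)) ^ j)" for j
    unfolding l_def by (rule chebyshev_comp_linear)
  then show "coeff (chebyshev_comp l j) j > 0" for j
    using assms by simp
  show "\<bar>poly (chebyshev_comp l j) x\<bar> \<le> 1" if "x \<in> {a..b}" for j x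
  proof (rule abs_poly_chebyshev_comp_le_1)
    have "poly l x = (2 * x - a - b) / (b - a)"
      by (simp add: l_def diff_divide_distrib add_divide_distrib)
    moreover have "\<bar>2 * x - a - b\<bar> \<le> b - a"
      using that by auto
    ultimately show "\<bar>poly l x\<bar> \<le> 1"
      using assms by simp
  qed
  show "0 < 3 * (sqrt (b - a) / 2) ^ n" using s by (simp add: s_def)
  have inv: "1 / coeff (chebyshev_comp l j) j \<le> 2 * s ^ (2 * j)" for j
  proof (cases j)
    case (Suc i)
    have "1 / coeff (chebyshev_comp l j) j = 2 * ((b - a) / 4) ^ j"
      using assms Suc by (simp add: lc power_divide field_simps flip: power_mult_distrib)
    also have "((b - a) / 4) ^ j = s ^ (2 * j)"
      by (simp only: s(2)[symmetric] power_mult)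
    finally show ?thesis by simp
  qed (simp add: lc)
  have "(\<Prod>j\<le>n. 1 / coeff (chebyshev_comp l j) j) \<le> (\<Prod>j\<le>n. 2 * s ^ (2 * j))"
    using inv \<open>\<And>j. coeff (chebyshev_comp l j) j > 0\<close> by (intro prod_mono) (simp add: less_imp_le)
  also have "\<dots> = (2 * s ^ n) ^ Suc n"
  proof -
    have "(\<Sum>j\<le>n. 2 * j) = n * Suc n"
      by (induction n) auto
    then show ?thesis
      by (simp add: prod.distrib power_sum[symmetric] power_mult_distrib power_mult[symmetric] del: power_Suc)
  qed
  also have "\<dots> < (3 * s ^ n) ^ Suc n"
    using s by (intro power_strict_mono) auto
  finally show "(\<Prod>j\<le>n. 1 / coeff (chebyshev_comp l j) j) < (3 * (sqrt (b - a) / 2) ^ n) ^ Suc n"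
    by (simp add: s_def)
qed

section \<open>Lower bounds from the leading coefficient\<close>

text \<open>The coefficients that decide the degree and the leading coefficient of the difference
  \<open>p (x + h) - p x\<close>.\<close>

lemma coeff_pcompose_shift:
  fixes p :: "'a::comm_ring_1 poly"
  assumes "degree p \<le> Suc d"
  shows "coeff (pcompose p [:h, 1:]) (Suc d) = coeff p (Suc d) \<and>
    coeff (pcompose p [:h, 1:]) d = coeff p d + of_nat (Suc d) * h * coeff p (Suc d)"
  using assms
proof (induction p arbitrary: d)
  case (pCons c r)
  have "degree r \<le> d"
    using pCons by (cases "r = 0") auto
  show ?case
  proof (cases d)
    case 0
    with \<open>degree r \<le> d\<close> obtain e where "r = [:e:]" by (auto elim: degree_eq_zeroE)
    with 0 show ?thesis by (simp add: coeff_pCons pcompose_pCons algebra_simps)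
  next
    case (Suc i)
    have "coeff (pcompose r [:h, 1:]) d = coeff r d"
      "coeff (pcompose r [:h, 1:]) i = coeff r i + of_nat d * h * coeff r d"
      using pCons.IH[of i] \<open>degree r \<le> d\<close> Suc by auto
    moreover have "coeff (pcompose r [:h, 1:]) (Suc d) = 0"
      using \<open>degree r \<le> d\<close> degree_pcompose_le[of r "[:h, 1:]"] by (intro coeff_eq_0) auto
    ultimately show ?thesis
      using Suc by (simp add: coeff_pCons pcompose_pCons algebra_simps)
  qed
qed auto

text \<open>The difference \<open>p (x + h) - p x\<close> has formal degree \<open>k - 1\<close>, leading coefficient \<open>k * h * coeff p k\<close>
  and bound \<open>2 * M\<close> on an interval that is shorter by \<open>h\<close>; after \<open>k\<close> differences a constant is left.\<close>

lemma coeff_bound_from_values: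
  fixes p :: "real poly"
  assumes "degree p \<le> k" and "h \<ge> 0" and "\<And>x. x \<in> {a..a + real k * h} \<Longrightarrow> \<bar>poly p x\<bar> \<le> M"
  shows "\<bar>coeff p k\<bar> * fact k * h ^ k \<le> 2 ^ k * M"
  using assms
proof (induction k arbitrary: p M)
  case 0
  then have "p = [:coeff p 0:]" by (auto elim: degree_eq_zeroE)
  then have "poly p a = coeff p 0" by (metis poly_const_conv)
  then show ?case using 0(3)[of a] by simp
next
  case (Suc k)
  define q where "q = pcompose p [:h, 1:] - p"
  have coeff_q: "coeff q k = real (Suc k) * h * coeff p (Suc k)"
    using coeff_pcompose_shift[OF Suc.prems(1), of h] by (simp add: q_def)
  have "degree q \<le> k"
  proof (rule degree_le, safe)
    fix i assume "k < i"
    then consider "i = Suc k" | "Suc k < i" by linarith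
    then show "coeff q i = 0"
    proof cases
      case 1
      then show ?thesis using coeff_pcompose_shift[OF Suc.prems(1), of h] by (simp add: q_def)
    next
      case 2
      then have "degree (pcompose p [:h, 1:]) < i" "degree p < i"
        using Suc.prems(1) degree_pcompose_le[of p "[:h, 1:]"] by auto
      then show ?thesis by (simp add: q_def coeff_eq_0)
    qed
  qed
  moreover have "\<bar>poly q x\<bar> \<le> 2 * M" if x: "x \<in> {a..a + real k * h}" for x
  proof -
    have "\<bar>poly p (x + h)\<bar> \<le> M" "\<bar>poly p x\<bar> \<le> M"
      using x Suc.prems(2) by (auto intro!: Suc.prems(3) simp: algebra_simps)
    then show ?thesis by (simp add: q_def poly_pcompose add.commute)
  qed
  ultimately have "\<bar>coeff q k\<bar> * fact k * h ^ k \<le> 2 ^ k * (2 * M)"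
    using Suc.IH Suc.prems(2) by blast
  moreover have "\<bar>coeff q k\<bar> = real (Suc k) * h * \<bar>coeff p (Suc k)\<bar>"
    unfolding coeff_q abs_mult using Suc.prems(2) by simp
  ultimately show ?case
    by (simp add: algebra_simps)
qed

lemma power_self_le_exp_fact: "real k ^ k \<le> exp (real k) * fact k"
proof -
  have "(\<Sum>n\<in>{k}. real k ^ n / fact n) \<le> (\<Sum>n. real k ^ n / fact n)"
    using summable_exp_generic[of "real k"]
    by (intro sum_le_suminf) (auto simp: divide_inverse_commute)
  then show ?thesis
    by (simp add: exp_def divide_inverse_commute[symmetric] field_simps)
qed

text \<open>For degree \<open>k\<close> the step \<open>h = (b - a) / k\<close> gives \<open>M \<ge> k! * (h / 2) ^ k\<close>, and \<open>k! \<ge> (k / e) ^ k\<close>.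
  The minimum with 1 makes the bound decreasing in the exponent, so that it only refers to the
  bound \<open>n\<close> on the degree.\<close>

lemma sup_lower_bound_of_leading_coeff:
  fixes p :: "real poly"
  assumes "a < b" and "degree p \<le> n" and "\<bar>lead_coeff p\<bar> \<ge> 1"
    and M: "\<And>x. x \<in> {a..b} \<Longrightarrow> \<bar>poly p x\<bar> \<le> M"
  shows "min 1 ((b - a) / (2 * exp 1)) ^ n \<le> M"
proof -
  define k where "k = degree p"
  define c where "c = (b - a) / (2 * exp 1)"
  have "c > 0" using \<open>a < b\<close> by (simp add: c_def)
  have "c ^ k \<le> M"
  proof (cases "k = 0")
    case True
    then show ?thesis
      using assms(1,3) M[of a] by (auto simp: k_def elim!: degree_eq_zeroE)
  next
    case False
    define h where "h = (b - a) / real k"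
    have h: "h \<ge> 0" "real k * h = b - a" using \<open>a < b\<close> False by (auto simp: h_def)
    have "\<bar>coeff p k\<bar> * fact k * h ^ k \<le> 2 ^ k * M"
      using h by (intro coeff_bound_from_values[of p k h a]) (auto simp: k_def intro!: M)
    moreover have "1 * (fact k * h ^ k) \<le> \<bar>coeff p k\<bar> * (fact k * h ^ k)"
      using assms(3) h by (intro mult_right_mono) (auto simp: k_def)
    ultimately have fact_le: "fact k * h ^ k \<le> 2 ^ k * M"
      unfolding mult.assoc mult_1_left by linarith
    have "(2 * exp 1 * c) ^ k = (b - a) ^ k" by (simp add: c_def)
    also have "\<dots> = real k ^ k * h ^ k" by (simp add: h(2)[symmetric] power_mult_distrib)
    also have "\<dots> \<le> exp (real k) * fact k * h ^ k"
      using h by (intro mult_right_mono power_self_le_exp_fact) auto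
    also have "\<dots> \<le> exp (real k) * (2 ^ k * M)"
      using mult_left_mono[OF fact_le, of "exp (real k)"] by (simp add: mult.assoc)
    also have "\<dots> = (2 * exp 1) ^ k * M"
      by (simp add: power_mult_distrib exp_of_nat_mult[of k 1, simplified])
    finally show ?thesis by (simp add: power_mult_distrib)
  qed
  moreover have "min 1 c ^ n \<le> min 1 c ^ k"
    using assms(2) \<open>c > 0\<close> by (intro power_decreasing) (auto simp: k_def)
  moreover have "min 1 c ^ k \<le> c ^ k"
    using \<open>c > 0\<close> by (intro power_mono) auto
  ultimately show ?thesis unfolding c_def by linarith
qed

section \<open>Fekete's lemma for submultiplicative sequences\<close>

text \<open>The limit is the infimum \<open>L\<close> of the roots. If \<open>r = root m (f m)\<close> is close to \<open>L\<close>, division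
  of \<open>n\<close> by \<open>m\<close> with remainder gives \<open>f n \<le> r ^ (n - n mod m) \<le> r ^ n / r ^ m\<close>, where the values of
  \<open>f\<close> at the remainders are absorbed by the bound \<open>f \<le> 1\<close>. The \<open>n\<close>-th root of \<open>r ^ m\<close> tends to 1.\<close>

lemma fekete_root_convergent:
  fixes f :: "nat \<Rightarrow> real"
  assumes pos: "\<And>n. f n > 0" and le1: "\<And>n. f n \<le> 1" and submult: "\<And>m n. f (m + n) \<le> f m * f n"
  shows "convergent (\<lambda>n. root n (f n))"
proof (rule convergentI)
  define L where "L = (INF n\<in>{0<..}. root n (f n))"
  have bdd: "bdd_below ((\<lambda>n. root n (f n)) ` {0<..})"
    using pos by (intro bdd_belowI[of _ 0]) (auto intro: less_imp_le)
  have lower: "L \<le> root m (f m)" if "m > 0" for m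
    unfolding L_def using that by (intro cINF_lower bdd) auto
  show "(\<lambda>n. root n (f n)) \<longlonglongrightarrow> L"
  proof (rule order_tendstoI)
    fix y assume "y < L"
    show "\<forall>\<^sub>F n in sequentially. y < root n (f n)"
      using eventually_gt_at_top[of 0]
    proof eventually_elim
      case (elim n)
      then show ?case using lower[of n] \<open>y < L\<close> by linarith
    qed
  next
    fix y assume "L < y"
    then obtain m where m: "m > 0" "root m (f m) < y"
      unfolding L_def by (subst (asm) cINF_less_iff[OF _ bdd]) auto
    define r where "r = root m (f m)"
    have r: "0 < r" "r \<le> 1" "f m = r ^ m"
      using m(1) pos[of m] le1[of m] by (auto simp: r_def)
    have mult: "f (m * q) \<le> r ^ (m * q)" for q
    proof (induction q)
      case (Suc q)
      have "f (m * Suc q) \<le> f m * f (m * q)" using submult[of m "m * q"] by simp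
      also have "\<dots> \<le> r ^ m * r ^ (m * q)"
        unfolding r(3) using Suc r by (intro mult_left_mono) auto
      finally show ?case by (simp add: power_add)
    qed (simp add: le1)
    have upper: "root n (f n) \<le> r / root n (r ^ m)" if "n > 0" for n
    proof -
      define s where "s = n mod m"
      have n: "m * (n div m) + s = n" and "s < m"
        using m(1) by (simp_all add: s_def)
      have "f n \<le> f (m * (n div m)) * f s" using submult[of "m * (n div m)" s] n by simp
      also have "\<dots> \<le> r ^ (m * (n div m)) * 1"
        using mult r le1 pos by (intro mult_mono) (auto intro: less_imp_le)
      also have "r ^ (m * (n div m)) * r ^ m \<le> r ^ (m * (n div m)) * r ^ s"
        using r \<open>s < m\<close> by (intro mult_left_mono power_decreasing) auto
      then have "r ^ (m * (n div m)) * 1 \<le> r ^ n / r ^ m"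
        using r n by (simp add: field_simps power_add[symmetric])
      finally have "root n (f n) \<le> root n (r ^ n / r ^ m)"
        using that by (simp add: real_root_le_iff)
      also have "\<dots> = r / root n (r ^ m)"
        using that r by (simp add: real_root_divide real_root_power_cancel)
      finally show ?thesis .
    qed
    have "(\<lambda>n. r / root n (r ^ m)) \<longlonglongrightarrow> r / 1"
      using r by (intro tendsto_divide tendsto_const LIMSEQ_root_const) auto
    then have "\<forall>\<^sub>F n in sequentially. r / root n (r ^ m) < y"
      using m(2) by (intro order_tendstoD) (auto simp: r_def)
    then show "\<forall>\<^sub>F n in sequentially. root n (f n) < y"
      using eventually_gt_at_top[of 0]
    proof eventually_elim
      case (elim n)
      then show ?case using upper[of n] by linarith
    qed
  qed
qed

section \<open>The integer Chebyshev constant\<close>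

definition min_sup_norm :: "real \<Rightarrow> real \<Rightarrow> nat \<Rightarrow> real" where
  "min_sup_norm a b n = (INF Q\<in>int_polys_le n - {0}. sup_norm_on a b (poly (map_poly real_of_int Q)))"

lemma abs_le_sup_norm_on:
  assumes "x \<in> {a..b}"
  shows "\<bar>poly p x\<bar> \<le> sup_norm_on a b (poly p)"
proof -
  have "compact ((\<lambda>x. \<bar>poly p x\<bar>) ` {a..b})"
    by (intro compact_continuous_image continuous_intros) auto
  then have "bdd_above ((\<lambda>x. \<bar>poly p x\<bar>) ` {a..b})"
    by (intro bounded_imp_bdd_above compact_imp_bounded)
  then show ?thesis
    unfolding sup_norm_on_def using assms by (rule cSUP_upper2) simp
qed

lemma sup_norm_on_le:
  assumes "a \<le> b" and "\<And>x. x \<in> {a..b} \<Longrightarrow> \<bar>f x\<bar> \<le> M"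
  shows "sup_norm_on a b f \<le> M"
  unfolding sup_norm_on_def using assms by (intro cSUP_least) auto

lemma sup_norm_on_nonneg: "a \<le> b \<Longrightarrow> 0 \<le> sup_norm_on a b (poly p)"
  using abs_le_sup_norm_on[of a a b p] by simp

lemma min_sup_norm_le:
  assumes "a \<le> b" and "Q \<noteq> 0" and "degree Q \<le> n"
    and "\<And>x. x \<in> {a..b} \<Longrightarrow> \<bar>poly (map_poly real_of_int Q) x\<bar> \<le> M"
  shows "min_sup_norm a b n \<le> M"
proof -
  have "bdd_below ((\<lambda>Q. sup_norm_on a b (poly (map_poly real_of_int Q))) ` (int_polys_le n - {0}))"
    using \<open>a \<le> b\<close> by (intro bdd_belowI[of _ 0]) (auto intro: sup_norm_on_nonneg)
  then have "min_sup_norm a b n \<le> sup_norm_on a b (poly (map_poly real_of_int Q))"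
    unfolding min_sup_norm_def using assms by (intro cINF_lower) (auto simp: int_polys_le_def)
  also have "\<dots> \<le> M"
    using assms by (intro sup_norm_on_le)
  finally show ?thesis .
qed

lemma le_min_sup_norm:
  assumes "\<And>Q. Q \<noteq> 0 \<Longrightarrow> degree Q \<le> n \<Longrightarrow> y \<le> sup_norm_on a b (poly (map_poly real_of_int Q))"
  shows "y \<le> min_sup_norm a b n"
  unfolding min_sup_norm_def
proof (rule cINF_greatest)
  have "1 \<in> int_polys_le n - {0}" by (simp add: int_polys_le_def)
  then show "int_polys_le n - {0} \<noteq> {}" by blast
qed (use assms in \<open>auto simp: int_polys_le_def\<close>)

lemma min_sup_norm_lower:
  assumes "a < b"
  shows "min 1 ((b - a) / (2 * exp 1)) ^ n \<le> min_sup_norm a b n"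
proof (rule le_min_sup_norm)
  fix Q :: "int poly" assume Q: "Q \<noteq> 0" "degree Q \<le> n"
  then have "\<bar>lead_coeff Q\<bar> \<ge> 1"
    using leading_coeff_neq_0[of Q] by linarith
  then have "\<bar>lead_coeff (map_poly real_of_int Q)\<bar> \<ge> 1"
    by simp
  then show "min 1 ((b - a) / (2 * exp 1)) ^ n \<le> sup_norm_on a b (poly (map_poly real_of_int Q))"
    using assms Q by (intro sup_lower_bound_of_leading_coeff[of a b "map_poly real_of_int Q"])
      (auto intro: abs_le_sup_norm_on)
qed

lemma min_sup_norm_pos:
  assumes "a < b"
  shows "0 < min_sup_norm a b n"
proof -
  have "0 < min 1 ((b - a) / (2 * exp 1)) ^ n" using assms by simp
  also note min_sup_norm_lower[OF assms]
  finally show ?thesis .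
qed

text \<open>The norm of a product is at most the product of the norms; the infimum is then taken over each
  factor in turn, after division by the other quantity, which is positive.\<close>

lemma min_sup_norm_submult:
  assumes "a < b"
  shows "min_sup_norm a b (m + n) \<le> min_sup_norm a b m * min_sup_norm a b n"
proof -
  let ?s = "\<lambda>Q. sup_norm_on a b (poly (map_poly real_of_int Q))"
  have prod: "min_sup_norm a b (m + n) \<le> ?s Q * ?s R"
    if "Q \<noteq> 0" "degree Q \<le> m" "R \<noteq> 0" "degree R \<le> n" for Q R
  proof (rule min_sup_norm_le[of a b "Q * R"])
    show "degree (Q * R) \<le> m + n"
      using that degree_mult_le[of Q R] by linarith
    show "\<bar>poly (map_poly real_of_int (Q * R)) x\<bar> \<le> ?s Q * ?s R" if "x \<in> {a..b}" for x
      using that assms unfolding of_int_poly_hom.hom_mult poly_mult abs_mult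
      by (intro mult_mono abs_le_sup_norm_on sup_norm_on_nonneg) auto
  qed (use assms that in auto)
  have pos: "0 < ?s R" if "R \<noteq> 0" "degree R \<le> n" for R
  proof -
    have "min_sup_norm a b n \<le> ?s R"
      using that assms by (intro min_sup_norm_le) (auto intro: abs_le_sup_norm_on)
    with min_sup_norm_pos[OF assms, of n] show ?thesis by linarith
  qed
  have "min_sup_norm a b (m + n) / min_sup_norm a b m \<le> ?s R"
    if R: "R \<noteq> 0" "degree R \<le> n" for R
  proof -
    have "min_sup_norm a b (m + n) / ?s R \<le> min_sup_norm a b m"
    proof (rule le_min_sup_norm)
      fix Q :: "int poly" assume "Q \<noteq> 0" "degree Q \<le> m"
      from prod[OF this R] show "min_sup_norm a b (m + n) / ?s R \<le> ?s Q"
        using pos[OF R] by (simp add: pos_divide_le_eq)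
    qed
    then show ?thesis
      using pos[OF R] min_sup_norm_pos[OF assms, of m] by (simp add: pos_divide_le_eq mult.commute)
  qed
  then have "min_sup_norm a b (m + n) / min_sup_norm a b m \<le> min_sup_norm a b n"
    by (intro le_min_sup_norm) auto
  then show ?thesis
    using min_sup_norm_pos[OF assms, of m] by (simp add: divide_le_eq mult.commute)
qed

lemma int_chebyshev_const_limit:
  assumes "a < b"
  shows "(\<lambda>n. root n (min_sup_norm a b n)) \<longlonglongrightarrow> int_chebyshev_const a b"
proof -
  have "min_sup_norm a b n \<le> 1" for n
    using assms by (intro min_sup_norm_le[of a b 1]) auto
  with min_sup_norm_pos[OF assms] have "convergent (\<lambda>n. root n (min_sup_norm a b n))"
    using min_sup_norm_submult[OF assms] by (rule fekete_root_convergent)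
  then show ?thesis
    unfolding int_chebyshev_const_def min_sup_norm_def[symmetric] by (simp add: convergent_LIMSEQ_iff)
qed

lemma int_chebyshev_const_pos:
  assumes "a < b"
  shows "0 < int_chebyshev_const a b"
proof -
  define c where "c = min 1 ((b - a) / (2 * exp 1))"
  have "0 < c" using assms by (simp add: c_def)
  have "c \<le> root n (min_sup_norm a b n)" if "n > 0" for n
    using min_sup_norm_lower[OF assms, of n] that \<open>0 < c\<close> unfolding c_def[symmetric]
    by (metis less_imp_le real_root_le_iff real_root_power_cancel)
  then have "c \<le> int_chebyshev_const a b"
    by (intro LIMSEQ_le_const[OF int_chebyshev_const_limit[OF assms]] exI[of _ 1]) auto
  with \<open>0 < c\<close> show ?thesis by simp
qed

lemma int_chebyshev_const_upper:
  assumes "a < b"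
  shows "int_chebyshev_const a b \<le> sqrt (b - a) / 2"
proof (rule LIMSEQ_le[OF int_chebyshev_const_limit[OF assms]])
  define s where "s = sqrt (b - a) / 2"
  have "0 < s" using assms by (simp add: s_def)
  have "(\<lambda>n. root n 3 * (root n (real n + 1) * s)) \<longlonglongrightarrow> 1 * (1 * s)"
  proof (intro tendsto_mult tendsto_const LIMSEQ_root_const)
    show "(\<lambda>n. root n (real n + 1)) \<longlonglongrightarrow> 1"
    proof (rule tendsto_sandwich)
      show "\<forall>\<^sub>F n in sequentially. 1 \<le> root n (real n + 1)"
        using eventually_gt_at_top[of 0] by eventually_elim simp
      show "\<forall>\<^sub>F n in sequentially. root n (real n + 1) \<le> root n 2 * root n (real n)"
        using eventually_gt_at_top[of 0]
        by eventually_elim (simp add: real_root_mult[symmetric])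
      show "(\<lambda>n. root n 2 * root n (real n)) \<longlonglongrightarrow> 1"
        using tendsto_mult[OF LIMSEQ_root_const[of 2] LIMSEQ_root] by simp
    qed simp
  qed simp
  then show "(\<lambda>n. root n 3 * (root n (real n + 1) * s)) \<longlonglongrightarrow> sqrt (b - a) / 2"
    by (simp add: s_def)
  show "\<exists>N. \<forall>n\<ge>N. root n (min_sup_norm a b n) \<le> root n 3 * (root n (real n + 1) * s)"
  proof (intro exI[of _ 1] allI impI)
    fix n :: nat assume "1 \<le> n"
    obtain Q :: "int poly" where "Q \<noteq> 0" "degree Q \<le> n"
      "\<And>x. x \<in> {a..b} \<Longrightarrow> \<bar>poly (map_poly real_of_int Q) x\<bar> \<le> real (Suc n) * (3 * s ^ n)"
      using small_int_poly_on_interval[OF assms, of n] unfolding s_def by blast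
    then have "min_sup_norm a b n \<le> real (Suc n) * (3 * s ^ n)"
      using assms by (intro min_sup_norm_le) auto
    then have "root n (min_sup_norm a b n) \<le> root n (3 * ((real n + 1) * s ^ n))"
      using \<open>1 \<le> n\<close> by (simp add: real_root_le_iff algebra_simps)
    also have "\<dots> = root n 3 * (root n (real n + 1) * s)"
      using \<open>1 \<le> n\<close> \<open>0 < s\<close> by (simp add: real_root_mult real_root_power_cancel)
    finally show "root n (min_sup_norm a b n) \<le> root n 3 * (root n (real n + 1) * s)" .
  qed
qed

section \<open>Leading coefficients of irreducible polynomials\<close>

text \<open>Over the complex numbers a polynomial with simple zeros has as many zeros as its degree.\<close>

lemma int_polys_simple_real_roots:
  assumes "P \<in> int_polys_simple n (complex_of_real ` I)"
  obtains x :: "nat \<Rightarrow> real" where "inj_on x {..<n}"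
    and "\<And>i. i < n \<Longrightarrow> x i \<in> I" and "\<And>i. i < n \<Longrightarrow> poly (map_poly of_int P) (x i) = 0"
proof -
  let ?p = "map_poly of_int P :: complex poly"
  have P: "P \<noteq> 0" "degree P = n"
    and simple: "\<And>z. poly ?p z = 0 \<Longrightarrow> order z ?p = 1 \<and> z \<in> complex_of_real ` I"
    using assms by (auto simp: int_polys_simple_def)
  define Z where "Z = {z. poly ?p z = 0}"
  have "?p \<noteq> 0" using P by simp
  then have "finite Z" unfolding Z_def by (rule poly_roots_finite)
  have "rsquarefree ?p"
    unfolding rsquarefree_def using \<open>?p \<noteq> 0\<close> simple order_root by blast
  then have "smult (lead_coeff ?p) (\<Prod>z\<in>Z. [:- z, 1:]) = ?p"
    unfolding Z_def by (rule complex_poly_decompose_rsquarefree)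
  then have "degree ?p = degree (\<Prod>z\<in>Z. [:- z, 1:])"
    using \<open>?p \<noteq> 0\<close> by (metis degree_smult_eq leading_coeff_0_iff)
  also have "\<dots> = card Z"
    by (subst degree_prod_eq_sum_degree) auto
  finally have "card Z = n" using P by simp
  then obtain z where z: "bij_betw z {..<n} Z"
    using \<open>finite Z\<close> by (metis atLeast0LessThan ex_bij_betw_nat_finite)
  have zZ: "z i \<in> Z" if "i < n" for i
    using z that by (auto simp: bij_betw_def)
  have real: "complex_of_real (Re (z i)) = z i" "Re (z i) \<in> I" if "i < n" for i
    using simple[of "z i"] zZ[OF that] by (auto simp: Z_def)
  show thesis
  proof
    show "inj_on (\<lambda>i. Re (z i)) {..<n}"
      using z real(1) unfolding bij_betw_def inj_on_def by (metis lessThan_iff)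
    show "poly (map_poly of_int P) (Re (z i)) = 0" if "i < n" for i
    proof -
      have "complex_of_real (poly (map_poly of_int P) (Re (z i))) = poly ?p (complex_of_real (Re (z i)))"
        by (induction P) (auto simp: map_poly_pCons)
      also have "\<dots> = 0"
        using real(1)[OF that] zZ[OF that] by (simp add: Z_def)
      finally show ?thesis by simp
    qed
  qed (rule real(2))
qed

text \<open>For every competitor \<open>Q\<close> in the definition of \<open>min_sup_norm a b m\<close>, the nonzero integer
  \<open>(\<Prod>i<n. Q (x i)) * lead_coeff P ^ m\<close> has absolute value at least 1 and at most
  \<open>\<parallel>Q\<parallel> ^ n * \<bar>lead_coeff P\<bar> ^ m\<close>.\<close>

lemma irreducible_leading_coeff_lower_bound:
  assumes "a < b" and P: "P \<in> int_polys_simple n (complex_of_real ` {a..b})"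
    and irr: "irreducible (map_poly rat_of_int P)" and "0 < m" and "m < n"
  shows "1 / root m (min_sup_norm a b m) \<le> root n \<bar>real_of_int (lead_coeff P)\<bar>"
proof -
  obtain x :: "nat \<Rightarrow> real" where x: "inj_on x {..<n}" "\<And>i. i < n \<Longrightarrow> x i \<in> {a..b}"
    "\<And>i. i < n \<Longrightarrow> poly (map_poly of_int P) (x i) = 0"
    using int_polys_simple_real_roots[OF P] by blast
  have deg: "degree P = n" and "P \<noteq> 0" using P by (auto simp: int_polys_simple_def)
  define A where "A = \<bar>real_of_int (lead_coeff P)\<bar>"
  have "A > 0" using \<open>P \<noteq> 0\<close> by (simp add: A_def)
  have "1 / root n A ^ m \<le> min_sup_norm a b m"
  proof (rule le_min_sup_norm)
    fix Q :: "int poly" assume Q: "Q \<noteq> 0" "degree Q \<le> m"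
    let ?q = "map_poly real_of_int Q" and ?s = "sup_norm_on a b (poly (map_poly real_of_int Q))"
    let ?R = "(\<Prod>i<n. poly ?q (x i)) * of_int (lead_coeff P) ^ m"
    have "poly ?q (x i) \<noteq> 0" if "i < n" for i
      using irreducible_no_common_root[OF irr _ Q(1) x(3)[OF that]] Q(2) \<open>m < n\<close> deg by simp
    then have "?R \<noteq> 0" using \<open>P \<noteq> 0\<close> by simp
    moreover have "?R \<in> \<int>"
      using x(1,3) deg Q(2) by (rule prod_values_at_roots_int)
    ultimately have "1 \<le> \<bar>?R\<bar>" by (intro Ints_nonzero_abs_ge1)
    also have "\<bar>?R\<bar> = (\<Prod>i<n. \<bar>poly ?q (x i)\<bar>) * A ^ m"
      by (simp add: abs_mult abs_prod power_abs A_def)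
    also have "\<dots> \<le> (\<Prod>i<n. ?s) * A ^ m"
      using x(2) \<open>A > 0\<close> by (intro mult_right_mono prod_mono) (auto intro: abs_le_sup_norm_on)
    finally have "1 \<le> ?s ^ n * A ^ m" by simp
    then have "root n 1 \<le> root n (?s ^ n * A ^ m)"
      using \<open>m < n\<close> by (subst real_root_le_iff) auto
    also have "\<dots> = ?s * root n A ^ m"
      using \<open>m < n\<close> \<open>A > 0\<close> \<open>a < b\<close>
      by (simp add: real_root_mult real_root_power_cancel real_root_power sup_norm_on_nonneg)
    finally show "1 / root n A ^ m \<le> ?s"
      using \<open>A > 0\<close> \<open>m < n\<close> by (simp add: divide_le_eq real_root_gt_zero)
  qed
  then have "root m (1 / root n A ^ m) \<le> root m (min_sup_norm a b m)"
    using \<open>0 < m\<close> by (simp add: real_root_le_iff)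
  moreover have "root m (1 / root n A ^ m) = 1 / root n A"
    using \<open>0 < m\<close> \<open>m < n\<close> \<open>A > 0\<close>
    by (simp add: real_root_divide real_root_power_cancel real_root_gt_zero less_imp_le)
  ultimately have "1 / root n A \<le> root m (min_sup_norm a b m)" by simp
  moreover have "0 < root m (min_sup_norm a b m)" "0 < root n A"
    using min_sup_norm_pos[OF \<open>a < b\<close>] \<open>0 < m\<close> \<open>m < n\<close> \<open>A > 0\<close> by (simp_all add: real_root_gt_zero)
  ultimately show ?thesis
    unfolding A_def[symmetric] by (simp add: divide_le_eq mult.commute)
qed

theorem theorem2p2:
  fixes a b :: real and N :: "nat set" and P :: "nat \<Rightarrow> int poly"
  assumes "a < b" and "b - a < 4"
    and "infinite N" and "\<forall>n\<in>N. 0 < n"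
    and "\<forall>n\<in>N. P n \<in> int_polys_simple n (complex_of_real ` {a..b})"
    and "\<forall>n\<in>N. irreducible (map_poly rat_of_int (P n))"
  shows "Liminf (inf sequentially (principal N))
             (\<lambda>n. ereal (root n \<bar>real_of_int (lead_coeff (P n))\<bar>))
           \<ge> ereal (1 / int_chebyshev_const a b)
         \<and> 1 / int_chebyshev_const a b \<ge> 2 / sqrt (b - a)"
proof
  let ?t = "int_chebyshev_const a b"
  let ?X = "\<lambda>n. ereal (root n \<bar>real_of_int (lead_coeff (P n))\<bar>)"
  have pos: "0 < ?t" using int_chebyshev_const_pos[OF \<open>a < b\<close>] .
  \<comment> \<open>for a fixed \<open>m\<close>, all but finitely many members of the sequence have degree above \<open>m\<close>\<close>
  have "ereal (1 / root m (min_sup_norm a b m)) \<le> Liminf (inf sequentially (principal N)) ?X"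
    if "0 < m" for m
  proof (rule Liminf_bounded)
    show "\<forall>\<^sub>F n in inf sequentially (principal N). ereal (1 / root m (min_sup_norm a b m)) \<le> ?X n"
      unfolding eventually_inf_principal using eventually_gt_at_top[of m]
    proof eventually_elim
      case (elim n)
      show ?case
      proof
        assume "n \<in> N"
        then have "1 / root m (min_sup_norm a b m) \<le> root n \<bar>real_of_int (lead_coeff (P n))\<bar>"
          using assms(1,5,6) \<open>0 < m\<close> elim by (intro irreducible_leading_coeff_lower_bound) blast+
        then show "ereal (1 / root m (min_sup_norm a b m)) \<le> ?X n"
          by (simp only: ereal_less_eq)
      qed
    qed
  qed
  then have lower: "\<exists>k. \<forall>m\<ge>k. ereal (1 / root m (min_sup_norm a b m))
      \<le> Liminf (inf sequentially (principal N)) ?X"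
    by (intro exI[of _ 1]) simp
  have "(\<lambda>m. 1 / root m (min_sup_norm a b m)) \<longlonglongrightarrow> 1 / ?t"
    using pos by (intro tendsto_divide tendsto_const int_chebyshev_const_limit[OF \<open>a < b\<close>]) simp
  then have "(\<lambda>m. ereal (1 / root m (min_sup_norm a b m))) \<longlonglongrightarrow> ereal (1 / ?t)"
    by (rule tendsto_ereal)
  then show "Liminf (inf sequentially (principal N)) ?X \<ge> ereal (1 / ?t)"
    using lower by (rule LIMSEQ_le_const2)
  have "2 / sqrt (b - a) = 1 / (sqrt (b - a) / 2)" by simp
  also have "\<dots> \<le> 1 / ?t"
    using pos \<open>a < b\<close> int_chebyshev_const_upper[OF \<open>a < b\<close>] by (intro divide_left_mono mult_pos_pos) auto
  finally show "1 / ?t \<ge> 2 / sqrt (b - a)" .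
qed

end
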